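(* Let $X_a,X_b\subset\mathbb{R}^2$ be two real algebraic curves, possibly with singularities, given via parametrizations $a(t)$ and $b(u)$, such that $X_a\cap X_b$ is finite or empty, and let $$\mathbb{B}:X_a\times X_b\to\mathbb{R},\qquad \mathbb{B}(t,u)=|a(t)-b(u)|^2 .$$ Assume (genericity) that the critical points $(a,b)$ of $\mathbb{B}$ satisfy $a\notin\Delta_b$ and $b\notin\Delta_a$. Then the topologically critical points of $\mathbb{B}$ are pairs $(a,b)$ of one of the following types: - rr-normals (traditional double normals), i.e. intervals $ab$ such that $ab$ is a normal at $a$ and $ba$ is a normal at $b$, where both $a$ and $b$ are regular points of $X_a$ and $X_b$ respectively; - rs-normals: one end point is a geometric singular point of one curve, and $ab$ is normal at the other end point, which is assumed to be regular; - ss-normals: intervals between two geometric singular points of $X_a$ and $X_b$; - the intersection points $X_a\cap X_b$.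
   Context: The curves are reduced real algebraic curves all of whose local branches are real and $1$-dimensional; $\mathbb{B}$ is considered on the product of the normalizations of the two curves. At each point a local branch is parametrized, in Euclidean coordinates with the point at the origin and first axis along the tangent line, by $(t^p,\,c\,t^q+\sigma_{q+1}(t))$ with $q>p$, $c\neq0$, all terms of $\sigma_{q+1}$ of degree $>q$. The point is a geometric singular (cuspidal) point if $p$ is even, and regular (at least $C^1$-smooth) if $p$ is odd. An interval $ab$ is normal at a regular point $a$ if it is orthogonal to the tangent line of the branch at $a$. $\mathbb{B}$ is topologically regular at $(a,b)$ if it is (locally, on the normalizations) topologically equivalent to a linear function, and topologically critical if it is not topologically regular. For a curve $X$ and $v\in\mathbb{R}^2$ let $\mathbb{D}_v(y)=|y-v|^2$, considered on the normalization of $X$; $v$ is topologically stable if $\mathbb{D}_w$ is topologically equivalent to $\mathbb{D}_v$ for all $w$ in a neighborhood of $v$ (the topological type being determined by the numbers of local maxima and minima on the normalized branches). $\Delta_a$ and $\Delta_b$ are the complements of the sets of stable points for $X_a$ and $X_b$ respectively. *)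

theory Defs
  imports
    "HOL-Analysis.Analysis"
    "HOL-Computational_Algebra.Computational_Algebra"
begin

section \<open>Real algebraic plane curves\<close>

text \<open>A polynomial in two variables is a polynomial in \<open>y\<close> whose coefficients are
  polynomials in \<open>x\<close>.\<close>

definition eval2 :: "'a::comm_ring_1 poly poly \<Rightarrow> 'a \<Rightarrow> 'a \<Rightarrow> 'a" where
  "eval2 f x y = poly (poly f [:y:]) x"

definition zero_locus :: "real poly poly \<Rightarrow> (real ^ 2) set" where
  "zero_locus f = {v. eval2 f (v $ 1) (v $ 2) = 0}"

definition complexify :: "real poly poly \<Rightarrow> complex poly poly" where
  "complexify f = map_poly (map_poly complex_of_real) f"

text \<open>A local branch of the complex curve at a real point is given by a nonconstant holomorphic
  germ \<open>(x(s), y(s))\<close>.  A branch different from its complex conjugate meets it, hence meets the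
  real plane, in an isolated point; so the branch is real and 1-dimensional iff real points of it
  accumulate at its centre.\<close>

definition branches_real :: "real poly poly \<Rightarrow> bool" where
  "branches_real f \<longleftrightarrow>
    (\<forall>x y. x analytic_on {0} \<and> y analytic_on {0} \<and> x 0 \<in> \<real> \<and> y 0 \<in> \<real> \<and>
           (\<forall>\<^sub>F s in nhds 0. eval2 (complexify f) (x s) (y s) = 0) \<and>
           \<not> (\<forall>\<^sub>F s in nhds 0. x s = x 0 \<and> y s = y 0)
       \<longrightarrow> (\<exists>\<^sub>F s in at 0. x s \<in> \<real> \<and> y s \<in> \<real>))"

definition real_algebraic_curve :: "(real ^ 2) set \<Rightarrow> bool" where
  "real_algebraic_curve X \<longleftrightarrow>
    (\<exists>f. \<not> is_unit f \<and> squarefree f \<and> branches_real f \<and> X = zero_locus f)"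

section \<open>Local branches and the normalization\<close>

text \<open>Near \<open>m\<close>, in the Euclidean coordinates with origin \<open>a m\<close> and orthonormal axes \<open>e\<close>, \<open>e'\<close>,
  the map \<open>a\<close> is \<open>t \<mapsto> (t ^ p, h t)\<close>, where \<open>h t = c t ^ q + \<sigma> t\<close> is a convergent power
  series with \<open>q = subdegree h > p\<close> and \<open>c = fps_nth h q \<noteq> 0\<close>; the case \<open>h = 0\<close> admits curves
  with straight line components.  The condition on common divisors of the exponents says that
  the parametrization is primitive, i.e. is not a series in \<open>t ^ d\<close> for some \<open>d > 1\<close>; in
  particular \<open>p = 1\<close> if \<open>h = 0\<close>.\<close>

definition local_branch ::
  "('m::topological_space \<Rightarrow> real ^ 2) \<Rightarrow> 'm \<Rightarrow> nat \<Rightarrow> real ^ 2 \<Rightarrow> real ^ 2 \<Rightarrow> real fps \<Rightarrow> bool"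
where
  "local_branch a m p e e' h \<longleftrightarrow>
    norm e = 1 \<and> norm e' = 1 \<and> orthogonal e e' \<and>
    p > 0 \<and> (h = 0 \<or> subdegree h > p) \<and>
    (\<forall>d. d dvd p \<and> (\<forall>n. fps_nth h n \<noteq> 0 \<longrightarrow> d dvd n) \<longrightarrow> d = 1) \<and>
    (\<exists>\<epsilon> U \<phi> \<psi>. \<epsilon> > 0 \<and> ereal \<epsilon> \<le> fps_conv_radius h \<and> open U \<and>
       homeomorphism {-\<epsilon><..<\<epsilon>} U \<phi> \<psi> \<and> \<phi> 0 = m \<and>
       (\<forall>t\<in>{-\<epsilon><..<\<epsilon>}. a (\<phi> t) = a m + t ^ p *\<^sub>R e + eval_fps h t *\<^sub>R e'))"

text \<open>The map \<open>a\<close>, defined on the whole of a Hausdorff space, exhibits this space as the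
  normalization of \<open>X\<close>: it is proper and onto \<open>X\<close>, every point of the space carries a local
  branch of \<open>X\<close>, and distinct points carry distinct branches (two distinct branches with a
  common centre have no other common point nearby).  Properness ensures that no branch of \<open>X\<close>
  is missed.\<close>

definition normalization :: "('m::t2_space \<Rightarrow> real ^ 2) \<Rightarrow> (real ^ 2) set \<Rightarrow> bool" where
  "normalization a X \<longleftrightarrow>
    range a = X \<and> continuous_on UNIV a \<and> proper_map euclidean euclidean a \<and>
    (\<forall>m. \<exists>p e e' h. local_branch a m p e e' h) \<and>
    (\<forall>m m'. m \<noteq> m' \<and> a m = a m' \<longrightarrow>
       (\<exists>U U'. open U \<and> open U' \<and> m \<in> U \<and> m' \<in> U' \<and> a ` U \<inter> a ` U' \<subseteq> {a m}))"

text \<open>The exponent \<open>p\<close> and the tangent line spanned by \<open>e\<close> depend only on \<open>a\<close> and \<open>m\<close>.\<close>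

definition geometric_singular :: "('m::topological_space \<Rightarrow> real ^ 2) \<Rightarrow> 'm \<Rightarrow> bool" where
  "geometric_singular a m \<longleftrightarrow> (\<exists>p e e' h. local_branch a m p e e' h \<and> even p)"

definition regular_point :: "('m::topological_space \<Rightarrow> real ^ 2) \<Rightarrow> 'm \<Rightarrow> bool" where
  "regular_point a m \<longleftrightarrow> (\<exists>p e e' h. local_branch a m p e e' h \<and> odd p)"

definition normal_at :: "('m::topological_space \<Rightarrow> real ^ 2) \<Rightarrow> 'm \<Rightarrow> real ^ 2 \<Rightarrow> bool" where
  "normal_at a m w \<longleftrightarrow> (\<exists>p e e' h. local_branch a m p e e' h \<and> orthogonal (w - a m) e)"

section \<open>Topological regularity and stability\<close>

text \<open>A local homeomorphism of the target could be absorbed into \<open>\<phi>\<close>, since \<open>L\<close> is not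
  constant.\<close>

definition topologically_regular :: "('z::topological_space \<Rightarrow> real) \<Rightarrow> 'z \<Rightarrow> bool" where
  "topologically_regular F z \<longleftrightarrow>
    (\<exists>U V \<phi> \<psi> L. open U \<and> z \<in> U \<and> open (V :: (real ^ 2) set) \<and> homeomorphism U V \<phi> \<psi> \<and>
       linear L \<and> L \<noteq> (\<lambda>x. 0) \<and> (\<forall>w\<in>U. F w - F z = L (\<phi> w) - L (\<phi> z)))"

definition topologically_critical :: "('z::topological_space \<Rightarrow> real) \<Rightarrow> 'z \<Rightarrow> bool" where
  "topologically_critical F z \<longleftrightarrow> \<not> topologically_regular F z"

definition sq_dist_pair :: "('m \<Rightarrow> real ^ 2) \<Rightarrow> ('n \<Rightarrow> real ^ 2) \<Rightarrow> 'm \<times> 'n \<Rightarrow> real" where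
  "sq_dist_pair a b = (\<lambda>(t, u). (norm (a t - b u))\<^sup>2)"

definition sq_dist_from :: "('m \<Rightarrow> real ^ 2) \<Rightarrow> real ^ 2 \<Rightarrow> 'm \<Rightarrow> real" where
  "sq_dist_from a v = (\<lambda>m. (norm (a m - v))\<^sup>2)"

definition local_maxima :: "('m::topological_space \<Rightarrow> real) \<Rightarrow> 'm set" where
  "local_maxima F = {m. \<forall>\<^sub>F x in nhds m. F x \<le> F m}"

definition local_minima :: "('m::topological_space \<Rightarrow> real) \<Rightarrow> 'm set" where
  "local_minima F = {m. \<forall>\<^sub>F x in nhds m. F m \<le> F x}"

text \<open>The topological type of a function on a normalized curve records the numbers of its local
  maxima and minima on every connected component; the order of the critical values is
  disregarded.  Cardinalities are compared by equipollence because all points of a circle are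
  extrema of the distance from its centre.\<close>

definition same_topological_type ::
  "('m::topological_space \<Rightarrow> real) \<Rightarrow> ('m \<Rightarrow> real) \<Rightarrow> bool" where
  "same_topological_type F G \<longleftrightarrow>
    (\<forall>C\<in>components UNIV. local_maxima F \<inter> C \<approx> local_maxima G \<inter> C \<and>
                            local_minima F \<inter> C \<approx> local_minima G \<inter> C)"

definition topologically_stable :: "('m::topological_space \<Rightarrow> real ^ 2) \<Rightarrow> real ^ 2 \<Rightarrow> bool" where
  "topologically_stable a v \<longleftrightarrow>
    (\<forall>\<^sub>F w in nhds v. same_topological_type (sq_dist_from a w) (sq_dist_from a v))"

definition unstable_locus :: "('m::topological_space \<Rightarrow> real ^ 2) \<Rightarrow> (real ^ 2) set" where
  "unstable_locus a = - {v. topologically_stable a v}"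

section \<open>Types of pairs\<close>

definition rr_normal ::
  "('m::topological_space \<Rightarrow> real ^ 2) \<Rightarrow> ('n::topological_space \<Rightarrow> real ^ 2) \<Rightarrow> 'm \<Rightarrow> 'n \<Rightarrow> bool"
where
  "rr_normal a b t u \<longleftrightarrow>
    regular_point a t \<and> regular_point b u \<and> normal_at a t (b u) \<and> normal_at b u (a t)"

definition rs_normal ::
  "('m::topological_space \<Rightarrow> real ^ 2) \<Rightarrow> ('n::topological_space \<Rightarrow> real ^ 2) \<Rightarrow> 'm \<Rightarrow> 'n \<Rightarrow> bool"
where
  "rs_normal a b t u \<longleftrightarrow>
    (geometric_singular a t \<and> regular_point b u \<and> normal_at b u (a t)) \<or>
    (geometric_singular b u \<and> regular_point a t \<and> normal_at a t (b u))"

definition ss_normal ::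
  "('m::topological_space \<Rightarrow> real ^ 2) \<Rightarrow> ('n::topological_space \<Rightarrow> real ^ 2) \<Rightarrow> 'm \<Rightarrow> 'n \<Rightarrow> bool"
where
  "ss_normal a b t u \<longleftrightarrow> geometric_singular a t \<and> geometric_singular b u"

end

theory Submission
  imports Defs
begin

text \<open>Suppose that the exponent \<open>p\<close> of the branch of \<open>a\<close> at \<open>t\<close> is odd and that \<open>b u - a t\<close> is
  not orthogonal to its tangent vector.  In the local parametrization \<open>(s ^ p, h s)\<close> the second
  coordinate is Lipschitz in the first one with an arbitrarily small constant, because
  \<open>h' s = O(s ^ p)\<close>.  Hence \<open>s \<mapsto> |a s - b r|\<^sup>2\<close> is injective on an interval that does not depend
  on \<open>r\<close> near \<open>u\<close>.  So \<open>(s, r) \<mapsto> (|a s - b r|\<^sup>2, r)\<close> is injective near \<open>(t, u)\<close>, and by invariance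
  of domain it is a chart in which the squared distance is a coordinate.  Consequently, at a
  critical pair every end point is singular or normal.\<close>

section \<open>Power series of higher order compared with an odd power\<close>

text \<open>Write \<open>h' = s ^ p * k\<close>. Its ratio to the derivative
  \<open>p * s ^ (p - 1)\<close> of \<open>s ^ p\<close> is \<open>s * k s / p\<close>, which tends
  to 0. For odd \<open>p\<close> the power is monotone across 0, so the comparison of derivatives
  integrates to all pairs \<open>s\<close>, \<open>s'\<close>, also on opposite sides of 0.\<close>

lemma fps_small_wrt_power:
  fixes h :: "real fps"
  assumes p: "odd p" and h: "h = 0 \<or> subdegree h > p" and r: "fps_conv_radius h > 0"
    and \<epsilon>: "\<epsilon> > 0"
  obtains \<delta> where "\<delta> > 0" "\<And>s s'. \<bar>s\<bar> < \<delta> \<Longrightarrow> \<bar>s'\<bar> < \<delta> \<Longrightarrow>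
      \<bar>eval_fps h s - eval_fps h s'\<bar> \<le> \<epsilon> * \<bar>s ^ p - s' ^ p\<bar>"
proof -
  define k where "k = fps_shift p (fps_deriv h)"
  have p0: "p > 0" using p by (rule odd_pos)
  \<comment> \<open>Coefficient \<open>n\<close> of the derivative is a multiple of coefficient
    \<open>n + 1\<close> of \<open>h\<close>, and
    \<open>n + 1 \<le> p < subdegree h\<close>.\<close>
  have "fps_nth (fps_deriv h) n = 0" if "n < p" for n
    using h that by (cases "h = 0") (auto intro!: nth_less_subdegree_zero)
  hence dh: "fps_deriv h = fps_X ^ p * k"
    by (intro fps_ext) (auto simp: k_def fps_X_power_mult_nth)
  have rd: "fps_conv_radius h \<le> fps_conv_radius (fps_deriv h)"
    by (rule fps_conv_radius_deriv)
  hence rk: "fps_conv_radius h \<le> fps_conv_radius k"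
    by (simp add: k_def)
  have "isCont (eval_fps k) 0"
    using r rk by (intro continuous_eval_fps) (auto simp: zero_ereal_def[symmetric])
  hence "((\<lambda>s. s * eval_fps k s) \<longlongrightarrow> 0 * eval_fps k 0) (at 0)"
    unfolding isCont_def by (intro tendsto_intros)
  moreover have "\<epsilon> * real p > 0" using \<epsilon> p0 by simp
  ultimately have "\<forall>\<^sub>F s in at 0. \<bar>s * eval_fps k s\<bar> < \<epsilon> * real p"
    by (auto simp: tendsto_iff dist_real_def)
  then obtain d where d: "d > 0" and
    small: "\<And>s. s \<noteq> 0 \<Longrightarrow> \<bar>s\<bar> < d \<Longrightarrow> \<bar>s * eval_fps k s\<bar> < \<epsilon> * real p"
    unfolding eventually_at by (auto simp: dist_real_def)
  obtain \<rho> where \<rho>: "\<rho> > 0" "ereal \<rho> < fps_conv_radius h"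
    using r by (metis ereal_dense2 ereal_less(2))
  define \<delta> where "\<delta> = min d \<rho>"
  have conv: "ereal \<bar>s\<bar> < fps_conv_radius h" if "\<bar>s\<bar> < \<delta>" for s
    using \<rho>(2) that by (auto simp: \<delta>_def intro: le_less_trans[of _ "ereal \<rho>"])
  have der: "(eval_fps h has_real_derivative s ^ p * eval_fps k s) (at s)" if "\<bar>s\<bar> < \<delta>" for s
  proof -
    have "(eval_fps h has_real_derivative eval_fps (fps_deriv h) s) (at s)"
      using conv[OF that] by (intro has_field_derivative_eval_fps) auto
    moreover have "eval_fps (fps_deriv h) s = s ^ p * eval_fps k s"
      using conv[OF that] rk unfolding dh
      by (subst eval_fps_mult) (auto intro: less_le_trans simp: eval_fps_power)
    ultimately show ?thesis by simp
  qed
  have bound: "\<bar>s ^ p * eval_fps k s\<bar> \<le> \<epsilon> * (real p * s ^ (p - 1))" if "\<bar>s\<bar> < \<delta>" for s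
  proof -
    \<comment> \<open>Oddness of \<open>p\<close> enters here: the derivative of
      \<open>s ^ p\<close> has no sign change at 0.\<close>
    have ev: "s ^ (p - 1) \<ge> 0" using p by (intro zero_le_even_power) auto
    have "\<bar>s * eval_fps k s\<bar> \<le> \<epsilon> * real p"
      using small[of s] that \<epsilon> by (cases "s = 0") (auto simp: \<delta>_def)
    hence "s ^ (p - 1) * \<bar>s * eval_fps k s\<bar> \<le> s ^ (p - 1) * (\<epsilon> * real p)"
      using ev by (rule mult_left_mono)
    moreover have "s ^ p = s ^ (p - 1) * s"
      using p0 by (metis power_minus_mult)
    ultimately show ?thesis
      using ev by (simp add: abs_mult mult_ac)
  qed
  have mono: "\<bar>eval_fps h s - eval_fps h s'\<bar> \<le> \<epsilon> * \<bar>s ^ p - s' ^ p\<bar>"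
    if "\<bar>s\<bar> < \<delta>" "\<bar>s'\<bar> < \<delta>" "s' \<le> s" for s s'
  proof -
    \<comment> \<open>The signs \<open>c = 1\<close> and \<open>c = -1\<close> give the two halves
      of the bound on the absolute value.\<close>
    have "\<epsilon> * s' ^ p + c * eval_fps h s' \<le> \<epsilon> * s ^ p + c * eval_fps h s"
      if c: "\<bar>c\<bar> = 1" for c
    proof (rule DERIV_nonneg_imp_nondecreasing[OF \<open>s' \<le> s\<close>])
      fix x assume "s' \<le> x" "x \<le> s"
      hence x: "\<bar>x\<bar> < \<delta>" using \<open>\<bar>s\<bar> < \<delta>\<close> \<open>\<bar>s'\<bar> < \<delta>\<close> by linarith
      have "((\<lambda>x. \<epsilon> * x ^ p + c * eval_fps h x) has_real_derivative
              \<epsilon> * (real p * x ^ (p - 1)) + c * (x ^ p * eval_fps k x)) (at x)"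
        by (rule derivative_eq_intros der[OF x] refl | simp)+
      moreover have "\<bar>c * (x ^ p * eval_fps k x)\<bar> \<le> \<epsilon> * (real p * x ^ (p - 1))"
        using bound[OF x] c by (subst abs_mult) simp
      ultimately show "\<exists>y. ((\<lambda>x. \<epsilon> * x ^ p + c * eval_fps h x) has_real_derivative y) (at x) \<and> 0 \<le> y"
        by (intro exI conjI) (assumption, linarith)
    qed
    from this[of 1] this[of "-1"] have "\<bar>eval_fps h s - eval_fps h s'\<bar> \<le> \<epsilon> * (s ^ p - s' ^ p)"
      by (simp add: right_diff_distrib)
    also have "\<dots> \<le> \<epsilon> * \<bar>s ^ p - s' ^ p\<bar>" using \<epsilon> by simp
    finally show ?thesis .
  qed
  show thesis
  proof
    show "\<delta> > 0" using d \<rho> by (simp add: \<delta>_def)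
    show "\<bar>eval_fps h s - eval_fps h s'\<bar> \<le> \<epsilon> * \<bar>s ^ p - s' ^ p\<bar>"
      if "\<bar>s\<bar> < \<delta>" "\<bar>s'\<bar> < \<delta>" for s s'
      using mono[of s s'] mono[of s' s] that by (cases "s' \<le> s") (auto simp: abs_minus_commute)
  qed
qed

section \<open>Points equidistant from a given point\<close>

text \<open>Expanding both squared distances, \<open>v \<bullet> v\<close> cancels and each
  remaining difference factors. If \<open>x \<noteq> x'\<close>, then \<open>lip\<close> and
  \<open>dom\<close> make the factored difference in the direction \<open>e\<close> strictly larger
  than the one in the direction \<open>e'\<close>, although they must be opposite.\<close>

lemma equidistant_orthonormal_coords:
  fixes e e' v :: "'a::real_inner"
  assumes "norm e = 1" "norm e' = 1" "orthogonal e e'"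
    and lip: "\<bar>y - y'\<bar> \<le> \<epsilon> * \<bar>x - x'\<bar>"
    and dom: "\<epsilon> * \<bar>y + y' - 2 * (v \<bullet> e')\<bar> < \<bar>x + x' - 2 * (v \<bullet> e)\<bar>"
    and eq: "norm (x *\<^sub>R e + y *\<^sub>R e' - v) = norm (x' *\<^sub>R e + y' *\<^sub>R e' - v)"
  shows "x = x'"
proof (rule ccontr)
  assume "x \<noteq> x'"
  have on: "e \<bullet> e = 1" "e' \<bullet> e' = 1" "e \<bullet> e' = 0" "e' \<bullet> e = 0"
    using assms(1-3) by (auto simp: norm_eq_1 orthogonal_def inner_commute)
  have "(norm (x *\<^sub>R e + y *\<^sub>R e' - v))\<^sup>2 = x\<^sup>2 + y\<^sup>2 - 2 * x * (v \<bullet> e) - 2 * y * (v \<bullet> e') + v \<bullet> v"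
    for x y
    unfolding power2_norm_eq_inner
    by (simp add: inner_simps on inner_commute[of e v] inner_commute[of e' v] power2_eq_square
        right_diff_distrib)
  from this[of x y] this[of x' y'] eq
  have "(x - x') * (x + x' - 2 * (v \<bullet> e)) = - ((y - y') * (y + y' - 2 * (v \<bullet> e')))"
    by (simp add: power2_eq_square algebra_simps)
  hence "\<bar>x - x'\<bar> * \<bar>x + x' - 2 * (v \<bullet> e)\<bar> = \<bar>y - y'\<bar> * \<bar>y + y' - 2 * (v \<bullet> e')\<bar>"
    by (metis abs_minus_cancel abs_mult)
  also have "\<dots> \<le> \<epsilon> * \<bar>x - x'\<bar> * \<bar>y + y' - 2 * (v \<bullet> e')\<bar>"
    using lip by (rule mult_right_mono) simp
  also have "\<dots> = \<bar>x - x'\<bar> * (\<epsilon> * \<bar>y + y' - 2 * (v \<bullet> e')\<bar>)" by simp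
  also have "\<dots> < \<bar>x - x'\<bar> * \<bar>x + x' - 2 * (v \<bullet> e)\<bar>"
    using dom \<open>x \<noteq> x'\<close> by (intro mult_strict_left_mono) auto
  finally show False by simp
qed

section \<open>Charts and topological regularity\<close>

text \<open>Injectivity of \<open>F\<close> on each slice of constant \<open>r\<close> makes
  \<open>(F \<circ> \<alpha>, snd)\<close> injective on \<open>S\<close>. Invariance of domain turns
  it into an open embedding in the plane, and in the resulting chart \<open>F\<close> is the first
  coordinate, a nonzero linear function.\<close>

lemma topologically_regular_coordinate:
  fixes F :: "'z::topological_space \<Rightarrow> real" and S :: "(real \<times> real) set"
  assumes "open S" "open N" "homeomorphism S N \<alpha> \<beta>" "z \<in> N" "continuous_on N F"
    and inj: "\<And>s s' r. (s, r) \<in> S \<Longrightarrow> (s', r) \<in> S \<Longrightarrow> F (\<alpha> (s, r)) = F (\<alpha> (s', r)) \<Longrightarrow> s = s'"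
  shows "topologically_regular F z"
proof -
  define G :: "real \<times> real \<Rightarrow> real ^ 2" where
    "G x = (\<chi> i. if i = 1 then F (\<alpha> x) else snd x)" for x
  have \<alpha>: "continuous_on S \<alpha>" "\<alpha> ` S = N" "\<And>w. w \<in> N \<Longrightarrow> \<alpha> (\<beta> w) = w"
    using homeomorphism_cont1[OF assms(3)] homeomorphism_image1[OF assms(3)]
      homeomorphism_apply2[OF assms(3)] by blast+
  have "continuous_on S (\<lambda>x. F (\<alpha> x))"
    using continuous_on_compose2[OF assms(5) \<alpha>(1)] \<alpha>(2) by blast
  hence "continuous_on S (\<lambda>x. if i = 1 then F (\<alpha> x) else snd x)" for i :: 2
    by (cases "i = 1") (simp_all add: continuous_on_snd)
  hence cG: "continuous_on S G"
    unfolding G_def by (rule continuous_on_vec_lambda)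
  have G1: "G x $ 1 = F (\<alpha> x)" and G2: "G x $ 2 = snd x" for x
    by (simp_all add: G_def)
  have iG: "inj_on G S"
  proof (rule inj_onI)
    fix x y assume xy: "x \<in> S" "y \<in> S" "G x = G y"
    obtain x1 x2 y1 y2 where [simp]: "x = (x1, x2)" "y = (y1, y2)" by fastforce
    have "F (\<alpha> x) = F (\<alpha> y)" "snd x = snd y"
      using G1[of x] G1[of y] G2[of x] G2[of y] xy(3) by simp_all
    with inj[of x1 x2 y1] xy(1,2) show "x = y" by simp
  qed
  \<comment> \<open>The remaining side condition compares the dimensions of
    \<open>real \<times> real\<close> and \<open>real ^ 2\<close>, both equal to 2.\<close>
  obtain g where g: "homeomorphism S (G ` S) G g"
    by (rule invariance_of_domain_homeomorphism[OF \<open>open S\<close> cG _ iG]) simp_all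
  have oG: "open (G ` S)"
    by (rule invariance_of_domain_gen[OF \<open>open S\<close> cG iG]) simp
  have "homeomorphism N S \<beta> \<alpha>"
    using assms(3) by (rule homeomorphism_symD)
  hence hom: "homeomorphism N (G ` S) (G \<circ> \<beta>) (\<alpha> \<circ> g)"
    using g by (rule homeomorphism_compose)
  define L :: "real ^ 2 \<Rightarrow> real" where "L v = v $ 1" for v
  have "linear L" unfolding L_def by (rule linearI) auto
  moreover have "L (axis 1 1) \<noteq> 0" by (simp add: L_def)
  hence "L \<noteq> (\<lambda>x. 0)" by auto
  moreover have "L ((G \<circ> \<beta>) w) = F w" if "w \<in> N" for w
    using that by (simp add: L_def G1 \<alpha>(3))
  hence "\<forall>w\<in>N. F w - F z = L ((G \<circ> \<beta>) w) - L ((G \<circ> \<beta>) z)"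
    using assms(4) by simp
  ultimately show ?thesis
    unfolding topologically_regular_def using assms(2,4) oG hom
    by (intro exI[of _ N] exI[of _ "G ` S"] exI[of _ "G \<circ> \<beta>"] exI[of _ "\<alpha> \<circ> g"] exI[of _ L] conjI)
qed

text \<open>A chart at the swapped point is pulled back along the homeomorphism
  \<open>prod.swap\<close>. This lets an argument about one end point serve for the other.\<close>

lemma topologically_regular_swap:
  assumes "topologically_regular F (prod.swap z)"
  shows "topologically_regular (F \<circ> prod.swap) z"
proof -
  obtain U and V :: "(real ^ 2) set" and \<phi> \<psi> L where
    U: "open U" "prod.swap z \<in> U" "open V" "homeomorphism U V \<phi> \<psi>"
    and L: "linear L" "L \<noteq> (\<lambda>x. 0)"
      "\<forall>w\<in>U. F w - F (prod.swap z) = L (\<phi> w) - L (\<phi> (prod.swap z))"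
    using assms unfolding topologically_regular_def by blast
  have cont: "continuous_on A prod.swap" for A :: "('x::topological_space \<times> 'y::topological_space) set"
    unfolding prod.swap_def by (intro continuous_intros)
  \<comment> \<open>The swap is an involution; the preimage form gives openness, the image form
    gives the homeomorphism.\<close>
  have eq: "prod.swap -` U = prod.swap ` U" by force
  have "open (prod.swap -` U)"
    using \<open>open U\<close> by (intro open_vimage cont) auto
  moreover have "homeomorphism (prod.swap -` U) U prod.swap prod.swap"
    unfolding eq by (rule homeomorphismI) (auto intro: cont simp: image_image)
  hence "homeomorphism (prod.swap -` U) V (\<phi> \<circ> prod.swap) (prod.swap \<circ> \<psi>)"
    using U(4) by (rule homeomorphism_compose)
  ultimately show ?thesis
    unfolding topologically_regular_def using U L
    by (intro exI[of _ "prod.swap -` U"] exI[of _ V] exI[of _ "\<phi> \<circ> prod.swap"]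
        exI[of _ "prod.swap \<circ> \<psi>"] exI[of _ L]) auto
qed

lemma local_branch_chart:
  assumes "local_branch a m p e e' h"
  obtains \<epsilon> U \<phi> \<psi> where "\<epsilon> > 0" "ereal \<epsilon> \<le> fps_conv_radius h" "open U"
    "homeomorphism {-\<epsilon><..<\<epsilon>} U \<phi> \<psi>" "\<phi> 0 = m"
    "\<And>s. s \<in> {-\<epsilon><..<\<epsilon>} \<Longrightarrow> a (\<phi> s) = a m + s ^ p *\<^sub>R e + eval_fps h s *\<^sub>R e'"
  using assms unfolding local_branch_def by blast

text \<open>Relatively open sets in the open set \<open>U\<close> are open in the whole space. Used
  to shrink the parameter intervals of branches.\<close>

lemma homeomorphism_restrict_open:
  assumes "homeomorphism S U \<phi> \<psi>" "open U" "open T" "T \<subseteq> S"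
  shows "open (\<phi> ` T)" "homeomorphism T (\<phi> ` T) \<phi> \<psi>"
proof -
  have "openin (top_of_set S) T" using assms(3,4) by (simp add: openin_open_eq open_subset)
  hence "openin (top_of_set U) (\<phi> ` T)"
    by (rule homeomorphism_imp_open_map[OF assms(1)])
  thus "open (\<phi> ` T)" using assms(2) openin_open_trans by blast
  have "\<phi> ` T \<subseteq> U" using assms(1,4) by (auto simp: homeomorphism_def)
  thus "homeomorphism T (\<phi> ` T) \<phi> \<psi>"
    using homeomorphism_of_subsets[OF assms(1)] assms(4) by blast
qed

lemma homeomorphism_map_prod:
  assumes "homeomorphism S U \<phi> \<psi>" "homeomorphism T V \<theta> \<omega>"
  shows "homeomorphism (S \<times> T) (U \<times> V) (map_prod \<phi> \<theta>) (map_prod \<psi> \<omega>)"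
proof -
  have c: "continuous_on (A \<times> B) (map_prod f g)"
    if "continuous_on A f" "continuous_on B g"
    for A B and f :: "'x::topological_space \<Rightarrow> 'y::topological_space"
      and g :: "'z::topological_space \<Rightarrow> 'w::topological_space"
    unfolding map_prod_def case_prod_unfold
    by (intro continuous_on_Pair continuous_on_compose2[OF that(1)]
        continuous_on_compose2[OF that(2)] continuous_intros) auto
  show ?thesis
    using assms unfolding homeomorphism_def
    by (intro conjI c) (auto simp: map_prod_surj_on)
qed

lemma isCont_near_0:
  fixes f :: "real \<Rightarrow> 'a::real_normed_vector"
  assumes "isCont f 0" "\<epsilon> > 0"
  obtains \<delta> where "\<delta> > 0" "\<And>s. \<bar>s\<bar> < \<delta> \<Longrightarrow> norm (f s - f 0) < \<epsilon>"
proof -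
  have "\<exists>\<delta>>0. \<forall>s. \<bar>s\<bar> < \<delta> \<longrightarrow> norm (f s - f 0) < \<epsilon>"
    using assms by (simp add: continuous_at_eps_delta dist_norm)
  thus ?thesis using that by blast
qed

section \<open>Regularity at a non-normal branch of odd exponent\<close>

lemma topologically_regular_if_not_normal:
  fixes a :: "'m::topological_space \<Rightarrow> real ^ 2" and b :: "'n::topological_space \<Rightarrow> real ^ 2"
  assumes ca: "continuous_on UNIV a" and cb: "continuous_on UNIV b"
    and ba: "local_branch a t p e e' h" and bb: "local_branch b u p' f f' h'"
    and "odd p" and nonorth: "\<not> orthogonal (b u - a t) e"
  shows "topologically_regular (sq_dist_pair a b) (t, u)"
proof -
  obtain \<epsilon>1 U \<phi> \<psi> where A: "\<epsilon>1 > 0" "ereal \<epsilon>1 \<le> fps_conv_radius h" "open U"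
    "homeomorphism {-\<epsilon>1<..<\<epsilon>1} U \<phi> \<psi>" "\<phi> 0 = t"
    "\<And>s. s \<in> {-\<epsilon>1<..<\<epsilon>1} \<Longrightarrow> a (\<phi> s) = a t + s ^ p *\<^sub>R e + eval_fps h s *\<^sub>R e'"
    using local_branch_chart[OF ba] by metis
  obtain \<epsilon>2 :: real and V :: "'n set" and \<theta> \<omega> where B: "\<epsilon>2 > 0" "open V"
    "homeomorphism {-\<epsilon>2<..<\<epsilon>2} V \<theta> \<omega>" "\<theta> 0 = u"
    using local_branch_chart[OF bb] by metis
  have br: "norm e = 1" "norm e' = 1" "orthogonal e e'" "p > 0" "h = 0 \<or> subdegree h > p"
    using ba by (auto simp: local_branch_def)
  have rad: "fps_conv_radius h > 0"
    using A(1,2) by (metis ereal_less(2) less_le_trans)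
  define v where "v r = b (\<theta> r) - a t" for r
  \<comment> \<open>For small parameters the factor along \<open>e\<close> exceeds
    \<open>c / 2\<close> and the factor along \<open>e'\<close> stays below \<open>2 * M\<close>.
    The slope \<open>\<kappa>\<close> is chosen so that \<open>\<kappa> * (2 * M) = c / 2\<close>.
    The summand 2 in \<open>M\<close> absorbs the bounds 1 on the two values of \<open>h\<close> and
    on the variation of \<open>v r \<bullet> e'\<close>.\<close>
  define c where "c = \<bar>v 0 \<bullet> e\<bar>"
  define M where "M = \<bar>v 0 \<bullet> e'\<bar> + 2"
  define \<kappa> where "\<kappa> = c / (4 * M)"
  have c: "c > 0" using nonorth by (simp add: c_def v_def B(4) orthogonal_def)
  have M: "M > 0" by (simp add: M_def)
  have \<kappa>: "\<kappa> > 0" using c M by (simp add: \<kappa>_def)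
  obtain d1 where d1: "d1 > 0" and lip: "\<And>s s'. \<bar>s\<bar> < d1 \<Longrightarrow> \<bar>s'\<bar> < d1 \<Longrightarrow>
      \<bar>eval_fps h s - eval_fps h s'\<bar> \<le> \<kappa> * \<bar>s ^ p - s' ^ p\<bar>"
    using fps_small_wrt_power[OF \<open>odd p\<close> br(5) rad \<kappa>] by blast
  have h0: "eval_fps h 0 = 0" using br(5) nth_less_subdegree_zero[of 0 h]
    unfolding eval_fps_at_0 by fastforce
  have "isCont (\<lambda>s::real. s ^ p) 0" by (intro continuous_intros)
  then obtain d2 where d2: "d2 > 0" and pow: "\<And>s. \<bar>s\<bar> < d2 \<Longrightarrow> \<bar>s ^ p\<bar> < c / 4"
    using isCont_near_0[of "\<lambda>s. s ^ p" "c / 4"] c br(4) by (auto simp: zero_power)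
  have "isCont (eval_fps h) 0"
    using rad by (intro continuous_eval_fps) (auto simp: zero_ereal_def[symmetric])
  then obtain d3 where d3: "d3 > 0" and hs: "\<And>s. \<bar>s\<bar> < d3 \<Longrightarrow> \<bar>eval_fps h s\<bar> < 1"
    using isCont_near_0[of "eval_fps h" 1] h0 by auto
  have c\<theta>: "continuous_on {-\<epsilon>2<..<\<epsilon>2} \<theta>" using B(3) by (simp add: homeomorphism_def)
  have "continuous_on {-\<epsilon>2<..<\<epsilon>2} v"
    unfolding v_def
    by (intro continuous_intros continuous_on_compose2[OF cb c\<theta>]) auto
  hence "isCont v 0"
    using B(1) by (simp add: continuous_on_eq_continuous_at)
  \<comment> \<open>The tolerance \<open>c / 4\<close> is meant for the projection to
    \<open>e\<close>, the tolerance 1 for the projection to \<open>e'\<close>.\<close>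
  moreover have "min (c / 4) 1 > 0" using c by simp
  ultimately obtain d4 where d4: "d4 > 0" and near: "\<And>r. \<bar>r\<bar> < d4 \<Longrightarrow> norm (v r - v 0) < min (c / 4) 1"
    using isCont_near_0 by blast
  have inner_near: "\<bar>v r \<bullet> n - v 0 \<bullet> n\<bar> < min (c / 4) 1" if "\<bar>r\<bar> < d4" "norm n = 1" for r n
  proof -
    have "\<bar>(v r - v 0) \<bullet> n\<bar> \<le> norm (v r - v 0)"
      using Cauchy_Schwarz_ineq2[of "v r - v 0" n] that(2) by simp
    with near[OF that(1)] show ?thesis by (simp add: inner_diff_left)
  qed
  \<comment> \<open>The width \<open>\<delta>\<close> does not depend on \<open>r\<close>, so
    injectivity in \<open>s\<close> holds on a full rectangle \<open>I \<times> J\<close>.\<close>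
  define \<delta> where "\<delta> = min \<epsilon>1 (min d1 (min d2 d3))"
  define \<eta> where "\<eta> = min \<epsilon>2 d4"
  define I where "I = {-\<delta><..<\<delta>}"
  define J where "J = {-\<eta><..<\<eta>}"
  have pos: "\<delta> > 0" "\<eta> > 0" using A(1) B(1) d1 d2 d3 d4 by (auto simp: \<delta>_def \<eta>_def)
  have hI: "open (\<phi> ` I)" "homeomorphism I (\<phi> ` I) \<phi> \<psi>"
    using homeomorphism_restrict_open[OF A(4,3), of I] by (simp_all add: I_def \<delta>_def greaterThanLessThan_subseteq_greaterThanLessThan)
  have hJ: "open (\<theta> ` J)" "homeomorphism J (\<theta> ` J) \<theta> \<omega>"
    using homeomorphism_restrict_open[OF B(3,2), of J] by (simp_all add: J_def \<eta>_def greaterThanLessThan_subseteq_greaterThanLessThan)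
  show ?thesis
  proof (rule topologically_regular_coordinate)
    show "open (I \<times> J)" by (auto simp: I_def J_def intro: open_Times)
    show "open (\<phi> ` I \<times> \<theta> ` J)" using hI(1) hJ(1) by (rule open_Times)
    show "homeomorphism (I \<times> J) (\<phi> ` I \<times> \<theta> ` J) (map_prod \<phi> \<theta>) (map_prod \<psi> \<omega>)"
      using hI(2) hJ(2) by (rule homeomorphism_map_prod)
    show "(t, u) \<in> \<phi> ` I \<times> \<theta> ` J"
      using pos A(5) B(4) by (force simp: I_def J_def)
    show "continuous_on (\<phi> ` I \<times> \<theta> ` J) (sq_dist_pair a b)"
      unfolding sq_dist_pair_def case_prod_unfold
      by (intro continuous_intros continuous_on_compose2[OF ca] continuous_on_compose2[OF cb]) auto
    fix s s' r
    assume "(s, r) \<in> I \<times> J" "(s', r) \<in> I \<times> J"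
      and eq: "sq_dist_pair a b (map_prod \<phi> \<theta> (s, r)) = sq_dist_pair a b (map_prod \<phi> \<theta> (s', r))"
    hence s: "\<bar>s\<bar> < \<delta>" "\<bar>s'\<bar> < \<delta>" "\<bar>r\<bar> < \<eta>" by (auto simp: I_def J_def)
    have as: "a (\<phi> x) - b (\<theta> r) = x ^ p *\<^sub>R e + eval_fps h x *\<^sub>R e' - v r" if "\<bar>x\<bar> < \<delta>" for x
    proof -
      have "x \<in> {-\<epsilon>1<..<\<epsilon>1}" using that by (auto simp: \<delta>_def)
      from A(6)[OF this] show ?thesis by (simp add: v_def)
    qed
    have "s ^ p = s' ^ p"
    proof (rule equidistant_orthonormal_coords[OF br(1-3)])
      show "\<bar>eval_fps h s - eval_fps h s'\<bar> \<le> \<kappa> * \<bar>s ^ p - s' ^ p\<bar>"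
        using s by (intro lip) (auto simp: \<delta>_def)
      show "norm (s ^ p *\<^sub>R e + eval_fps h s *\<^sub>R e' - v r) =
            norm (s' ^ p *\<^sub>R e + eval_fps h s' *\<^sub>R e' - v r)"
        using eq as[OF s(1)] as[OF s(2)] by (simp add: sq_dist_pair_def)
      have "\<bar>eval_fps h s\<bar> < 1" "\<bar>eval_fps h s'\<bar> < 1"
        using s by (intro hs; simp add: \<delta>_def)+
      moreover have "\<bar>v r \<bullet> e' - v 0 \<bullet> e'\<bar> < 1"
        using inner_near[of r e'] br(2) s(3) by (simp add: \<eta>_def)
      ultimately have up: "\<bar>eval_fps h s + eval_fps h s' - 2 * (v r \<bullet> e')\<bar> < 2 * M"
        using abs_ge_self[of "v 0 \<bullet> e'"] abs_ge_minus_self[of "v 0 \<bullet> e'"]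
        unfolding M_def abs_less_iff by argo
      have "\<bar>s ^ p\<bar> < c / 4" "\<bar>s' ^ p\<bar> < c / 4"
        using s by (intro pow; simp add: \<delta>_def)+
      moreover have "\<bar>v r \<bullet> e - v 0 \<bullet> e\<bar> < c / 4"
        using inner_near[of r e] br(1) s(3) by (simp add: \<eta>_def)
      ultimately have low: "c / 2 < \<bar>s ^ p + s' ^ p - 2 * (v r \<bullet> e)\<bar>"
        unfolding c_def by linarith
      have "\<kappa> * \<bar>eval_fps h s + eval_fps h s' - 2 * (v r \<bullet> e')\<bar> < \<kappa> * (2 * M)"
        using up \<kappa> by (rule mult_strict_left_mono)
      also have "\<dots> = c / 2" using M by (simp add: \<kappa>_def)
      finally show "\<kappa> * \<bar>eval_fps h s + eval_fps h s' - 2 * (v r \<bullet> e')\<bar>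
          < \<bar>s ^ p + s' ^ p - 2 * (v r \<bullet> e)\<bar>"
        using low by linarith
    qed
    \<comment> \<open>The geometry only identifies the \<open>p\<close>-th powers; an even power
      would leave the sign of \<open>s\<close> open.\<close>
    thus "s = s'" using \<open>odd p\<close> by (metis odd_real_root_power_cancel)
  qed
qed

section \<open>End points of critical pairs\<close>

text \<open>An even exponent is a geometric singular point by definition; with an odd exponent,
  failure of normality would make the pair regular.\<close>

lemma critical_singular_or_normal:
  fixes a :: "'m::topological_space \<Rightarrow> real ^ 2" and b :: "'n::topological_space \<Rightarrow> real ^ 2"
  assumes "continuous_on UNIV a" "continuous_on UNIV b"
    and ba: "local_branch a t p e e' h" and "local_branch b u p' f f' h'"
    and "topologically_critical (sq_dist_pair a b) (t, u)"
  shows "geometric_singular a t \<or> regular_point a t \<and> normal_at a t (b u)"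
proof (cases "even p")
  case True
  thus ?thesis using ba by (auto simp: geometric_singular_def)
next
  case False
  hence "orthogonal (b u - a t) e"
    using topologically_regular_if_not_normal assms unfolding topologically_critical_def by blast
  thus ?thesis
    using False ba by (auto simp: regular_point_def normal_at_def)
qed

lemma sq_dist_pair_swap: "sq_dist_pair a b = sq_dist_pair b a \<circ> prod.swap"
  by (auto simp: sq_dist_pair_def norm_minus_commute)

theorem proposition7:
  fixes a :: "'m::t2_space \<Rightarrow> real ^ 2" and b :: "'n::t2_space \<Rightarrow> real ^ 2"
    and Xa Xb :: "(real ^ 2) set"
  assumes "real_algebraic_curve Xa" and "normalization a Xa"
    and "real_algebraic_curve Xb" and "normalization b Xb"
    and "finite (Xa \<inter> Xb)"
    and generic: "\<And>t u. topologically_critical (sq_dist_pair a b) (t, u) \<Longrightarrow>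
           a t \<notin> unstable_locus b \<and> b u \<notin> unstable_locus a"
    and critical: "topologically_critical (sq_dist_pair a b) (t, u)"
  shows "rr_normal a b t u \<or> rs_normal a b t u \<or> ss_normal a b t u \<or>
         (a t = b u \<and> a t \<in> Xa \<inter> Xb)"
proof -
  have cont: "continuous_on UNIV a" "continuous_on UNIV b"
    using assms(2,4) by (auto simp: normalization_def)
  obtain p e e' h where ba: "local_branch a t p e e' h"
    using assms(2) unfolding normalization_def by metis
  obtain p' f f' h' where bb: "local_branch b u p' f f' h'"
    using assms(4) unfolding normalization_def by metis
  \<comment> \<open>By symmetry of the distance, regularity of the swapped pair would carry back to
    \<open>(t, u)\<close>.\<close>
  have "topologically_critical (sq_dist_pair b a) (u, t)"
    using critical topologically_regular_swap[of "sq_dist_pair b a" "(t, u)"]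
    unfolding topologically_critical_def sq_dist_pair_swap[of a b] by auto
  hence "geometric_singular b u \<or> regular_point b u \<and> normal_at b u (a t)"
    using critical_singular_or_normal[OF cont(2,1) bb ba] by blast
  moreover have "geometric_singular a t \<or> regular_point a t \<and> normal_at a t (b u)"
    using critical_singular_or_normal[OF cont ba bb critical] .
  \<comment> \<open>The two alternatives at each end combine to rr, rs (in two ways) and ss. A pair
    with \<open>a t = b u\<close> is covered too, since the zero vector is orthogonal to every
    tangent.\<close>
  ultimately show ?thesis
    unfolding rr_normal_def rs_normal_def ss_normal_def by blast
qed

end
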